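(* Let $a_n$ denote the number of complete rulers of length $n$, i.e. the number of subsets $R \subseteq \{0,1,\dots,n\}$ such that $\{0,1,\dots,n\} \subseteq R-R$. Then there is a constant $c$ with $0.2433 < c < 0.2451$ such that $a_n \sim c\cdot 2^n$ as $n\to\infty$ (i.e. $a_n/2^n \to c$).
   Context: For a set $R$ of integers, $R-R := \{x-y : x,y\in R\}$. A ruler of length $L$ is any subset $R \subseteq \{0,\dots,L\}$; it is complete if $\{0,\dots,L\}\subseteq R-R$. (This is OEIS sequence A103295.) *)

theory Defs
  imports Complex_Main
begin

(* The infix minus on sets is set difference in HOL, so R - R needs its own constant. *)
definition diff_set :: "int set \<Rightarrow> int set" where
  "diff_set R = {x - y | x y. x \<in> R \<and> y \<in> R}"

definition ruler :: "nat \<Rightarrow> int set \<Rightarrow> bool" where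
  "ruler L R \<longleftrightarrow> R \<subseteq> {0..int L}"

definition complete_ruler :: "nat \<Rightarrow> int set \<Rightarrow> bool" where
  "complete_ruler L R \<longleftrightarrow> ruler L R \<and> {0..int L} \<subseteq> diff_set R"

definition num_complete_rulers :: "nat \<Rightarrow> nat" where
  "num_complete_rulers n = card {R. complete_ruler n R}"

end

theory Submission
  imports Defs
begin

text \<open>
  Write A for the low end of a ruler R of length n and B for the low end of the reflected ruler
  n - R. The difference n - k occurs in R iff k is a sum of an element of A and an element
  of B. Differences far below n are missing only with exponentially small probability, so
  the number of complete rulers divided by 2 ^ (n + 1) converges to the probability p that two independent uniformly
  random sets A, B of natural numbers satisfy A + B = UNIV, and c = 2p.

  To locate p, the bits of A and B are revealed two at a time. Given finite prefixes, the conditional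
  probability that k is not a sum is an explicit product, and so is the probability that two given
  numbers both fail to be sums. The union bound and the second Bonferroni inequality then enclose the
  conditional probability that some number is not a sum; a prefix is extended until the mass of its
  union bound is small, and the enclosures of the resulting few thousand prefixes are added up.
\<close>

section \<open>Sums of revealed bits and the covering probability\<close>

definition covered :: "bool list \<Rightarrow> bool list \<Rightarrow> nat \<Rightarrow> bool" where
  "covered A B k \<longleftrightarrow> (\<exists>i\<le>k. i < length A \<and> k - i < length B \<and> A ! i \<and> B ! (k - i))"

text \<open>The probability that, after appending d random bits to each of A and B, every k below the
  common length is covered.\<close>

fun cover_prob :: "nat \<Rightarrow> bool list \<Rightarrow> bool list \<Rightarrow> real" where
  "cover_prob 0 A B = of_bool (\<forall>k<length A. covered A B k)"
| "cover_prob (Suc d) A B =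
     (cover_prob d (A @ [False]) (B @ [False]) + cover_prob d (A @ [False]) (B @ [True])
    + cover_prob d (A @ [True]) (B @ [False]) + cover_prob d (A @ [True]) (B @ [True])) / 4"

text \<open>A representation of \<open>k\<close> uses only positions up to \<open>k\<close>, so the
  fate of a number below the common length is settled.\<close>

lemma covered_snoc_less:
  assumes "k < length A" "length A = length B"
  shows "covered (A @ [a]) (B @ [b]) k \<longleftrightarrow> covered A B k"
  unfolding covered_def using assms by (auto simp: nth_append)

lemma covered_commute: "covered A B k \<longleftrightarrow> covered B A k"
proof -
  have *: "covered B A k" if "covered A B k" for A B
  proof -
    from that obtain i where "i \<le> k" "i < length A" "k - i < length B" "A ! i" "B ! (k - i)"
      unfolding covered_def by blast
    then show ?thesis unfolding covered_def by (intro exI[of _ "k - i"]) auto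
  qed
  show ?thesis using *[of A B] *[of B A] by blast
qed

lemma cover_prob_nonneg: "0 \<le> cover_prob d A B"
  by (induction d A B rule: cover_prob.induct) auto

lemma cover_prob_le_1: "cover_prob d A B \<le> 1"
  by (induction d A B rule: cover_prob.induct) auto

lemma cover_prob_commute:
  "length A = length B \<Longrightarrow> cover_prob d A B = cover_prob d B A"
proof (induction d A B rule: cover_prob.induct)
  case (1 A B)
  then show ?case by (simp add: covered_commute[of A B])
qed (simp add: add.commute add.left_commute)

lemma cover_prob_eq_0:
  assumes "length A = length B" "k < length A" "\<not> covered A B k"
  shows "cover_prob d A B = 0"
  using assms
proof (induction d A B rule: cover_prob.induct)
  case (2 d A B)
  then show ?case by (simp add: covered_snoc_less)
qed auto

text \<open>Monotonicity in \<open>d\<close> is what makes the limit exist: one more pair of bits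
  keeps all old requirements and adds one.\<close>

lemma cover_prob_Suc_le:
  "length A = length B \<Longrightarrow> cover_prob (Suc d) A B \<le> cover_prob d A B"
proof (induction d A B rule: cover_prob.induct)
  case (1 A B)
  show ?case
  proof (cases "\<forall>k<length A. covered A B k")
    case True
    then show ?thesis using cover_prob_le_1[of "Suc 0" A B] by simp
  next
    case False
    then obtain k where "k < length A" "\<not> covered A B k" by blast
    then have "cover_prob (Suc 0) A B = 0" by (rule cover_prob_eq_0[OF 1])
    then show ?thesis using cover_prob_nonneg[of 0 A B] by (simp only:)
  qed
next
  case (2 d A B)
  then have "length (A @ [a]) = length (B @ [b])" for a b by simp
  note IH = 2(1-4)[OF this]
  show ?case
    by (subst cover_prob.simps(2), subst (4) cover_prob.simps(2))
      (intro divide_right_mono add_mono IH, simp)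
qed

section \<open>Rulers and pairs of bit strings\<close>

text \<open>Rulers whose first bits are A and whose last bits, read from n downwards, are B.\<close>

definition agree :: "nat \<Rightarrow> bool list \<Rightarrow> bool list \<Rightarrow> nat set set" where
  "agree n A B = {R. R \<subseteq> {..n} \<and> (\<forall>i<length A. (i \<in> R) = A ! i \<and> (n - i \<in> R) = B ! i)}"

lemma finite_agree [simp]: "finite (agree n A B)"
  by (rule finite_subset[of _ "Pow {..n}"]) (auto simp: agree_def)

text \<open>The prefixes prescribe \<open>2 * length A\<close> positions, distinct because
  \<open>2 * length A \<le> n + 1\<close>; the middle positions stay free.\<close>

lemma card_agree:
  assumes "length A = length B" "2 * length A \<le> n + 1"
  shows "card (agree n A B) = 2 ^ (n + 1 - 2 * length A)"
proof -
  define m where "m = length A"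
  \<comment> \<open>\<open>C\<close> collects the elements forced by the prefixes; the agreeing sets
    are \<open>C\<close> plus any subset of the middle block.\<close>
  define C where "C = {i. i < m \<and> A ! i} \<union> (\<lambda>i. n - i) ` {i. i < m \<and> B ! i}"
  have m: "2 * m \<le> n + 1" using assms by (simp add: m_def)
  have C1: "i \<in> C \<longleftrightarrow> A ! i" if "i < m" for i
    using that m by (auto simp: C_def)
  have C2: "n - i \<in> C \<longleftrightarrow> B ! i" if "i < m" for i
  proof
    assume "n - i \<in> C"
    then consider "n - i < m" | j where "j < m" "B ! j" "n - i = n - j"
      unfolding C_def by auto
    then show "B ! i"
    proof cases
      case 2
      then have "i = j" using that m by arith
      with 2 show ?thesis by simp
    qed (use that m in arith)
  next
    assume "B ! i" then show "n - i \<in> C" unfolding C_def using that by auto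
  qed
  have C3: "C \<subseteq> {..n}" using m by (auto simp: C_def)
  have C4: "C \<inter> {m..<n + 1 - m} = {}" using m by (auto simp: C_def)
  have img: "agree n A B = (\<lambda>S. C \<union> S) ` Pow {m..<n + 1 - m}"
  proof (intro equalityI subsetI)
    fix R assume R: "R \<in> agree n A B"
    have "x \<in> R \<longleftrightarrow> x \<in> C \<union> (R \<inter> {m..<n + 1 - m})" for x
    proof -
      consider "x < m" | "x > n" | "m \<le> x" "x < n + 1 - m" | "n - x < m" "x \<le> n" by linarith
      then show ?thesis
      proof cases
        case 1 then show ?thesis using R C1[of x] by (auto simp: agree_def m_def)
      next
        case 2 then show ?thesis using R C3 by (auto simp: agree_def)
      next
        case 3 then show ?thesis using C4 by auto
      next
        case 4
        then have "x \<in> R \<longleftrightarrow> B ! (n - x)" using R by (auto simp: agree_def m_def)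
        moreover have "x \<in> C \<longleftrightarrow> B ! (n - x)" using C2[OF 4(1)] 4(2) by simp
        moreover have "x \<notin> {m..<n + 1 - m}" using 4 by auto
        ultimately show ?thesis by blast
      qed
    qed
    then have "R = C \<union> (R \<inter> {m..<n + 1 - m})" by blast
    then show "R \<in> (\<lambda>S. C \<union> S) ` Pow {m..<n + 1 - m}" by blast
  next
    fix R assume "R \<in> (\<lambda>S. C \<union> S) ` Pow {m..<n + 1 - m}"
    then obtain S where S: "S \<subseteq> {m..<n + 1 - m}" "R = C \<union> S" by auto
    have "i \<notin> S" "n - i \<notin> S" if "i < m" for i
      using S that m by (auto dest!: subsetD)
    moreover have "{m..<n + 1 - m} \<subseteq> {..n}" by auto
    then have "S \<subseteq> {..n}" using S by blast
    ultimately show "R \<in> agree n A B"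
      using S C1 C2 C3 unfolding agree_def m_def[symmetric] by auto
  qed
  have "inj_on (\<lambda>S. C \<union> S) (Pow {m..<n + 1 - m})"
    using C4 by (intro inj_onI) blast
  then have "card (agree n A B) = 2 ^ card {m..<n + 1 - m}"
    unfolding img by (simp add: card_image card_Pow)
  also have "card {m..<n + 1 - m} = n + 1 - 2 * m" by simp
  finally show ?thesis by (simp add: m_def)
qed

text \<open>For \<open>i \<le> k \<le> n\<close> the two members differ by \<open>n - k\<close>. In
  this form \<open>k = i + (k - i)\<close> with \<open>i\<close> in the low end and
  \<open>k - i\<close> in the reflected low end, which matches \<open>covered\<close>.\<close>

definition has_long_differences :: "nat \<Rightarrow> nat \<Rightarrow> nat set \<Rightarrow> bool" where
  "has_long_differences n M R \<longleftrightarrow> (\<forall>k<M. \<exists>i\<le>k. i \<in> R \<and> n - (k - i) \<in> R)"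

lemma card_split_4:
  assumes "finite X"
  shows "card X = card {x \<in> X. P x = False \<and> Q x = False} + card {x \<in> X. P x = False \<and> Q x = True}
    + card {x \<in> X. P x = True \<and> Q x = False} + card {x \<in> X. P x = True \<and> Q x = True}"
proof -
  have *: "card Y = card {x \<in> Y. \<not> P x} + card {x \<in> Y. P x}" if "finite Y" for Y P
    using that by (subst card_Un_disjoint[symmetric]) (auto intro!: arg_cong[where f = card])
  show ?thesis
    using *[OF assms, of P] *[of "{x \<in> X. \<not> P x}" Q] *[of "{x \<in> X. P x}" Q] assms
    by (simp add: conj_ac)
qed

text \<open>Splitting by membership of \<open>m\<close> and \<open>n - m\<close> mirrors the
  recursion of \<open>cover_prob\<close>. Counts of rulers thus become probabilities exactly, as
  long as the two ends do not overlap.\<close>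

lemma card_agree_long_differences:
  assumes "length A = length B" "2 * (length A + d) \<le> n + 1"
  shows "real (card {R \<in> agree n A B. has_long_differences n (length A + d) R})
       = 2 ^ (n + 1 - 2 * length A) * cover_prob d A B"
  using assms
proof (induction d arbitrary: A B)
  case 0
  have "has_long_differences n (length A) R \<longleftrightarrow> (\<forall>k<length A. covered A B k)"
    if "R \<in> agree n A B" for R
  proof -
    have "(\<exists>i\<le>k. i \<in> R \<and> n - (k - i) \<in> R) \<longleftrightarrow> covered A B k" if "k < length A" for k
    proof -
      have "i \<in> R \<and> n - (k - i) \<in> R \<longleftrightarrow> i < length A \<and> k - i < length B \<and> A ! i \<and> B ! (k - i)"
        if "i \<le> k" for i
        using \<open>R \<in> agree n A B\<close> \<open>k < length A\<close> that 0(1)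
        by (simp add: agree_def less_imp_diff_less del: diff_diff_right Nat.diff_diff_right)
      then show ?thesis unfolding covered_def by blast
    qed
    then show ?thesis unfolding has_long_differences_def by blast
  qed
  then have "{R \<in> agree n A B. has_long_differences n (length A + 0) R}
      = (if \<forall>k<length A. covered A B k then agree n A B else {})"
    by auto
  then show ?case using card_agree[of A B n] 0 by simp
next
  case (Suc d)
  define m where "m = length A"
  let ?X = "{R \<in> agree n A B. has_long_differences n (m + Suc d) R}"
  let ?Y = "\<lambda>a b. {R \<in> agree n (A @ [a]) (B @ [b]). has_long_differences n (m + Suc d) R}"
  have m: "2 * (m + Suc d) \<le> n + 1" "length B = m" using Suc.prems by (simp_all add: m_def)
  have Y: "?Y a b = {R \<in> ?X. (m \<in> R) = a \<and> (n - m \<in> R) = b}" for a b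
  proof -
    have "(\<forall>i<m. (i \<in> R) = (A @ [a]) ! i \<and> (n - i \<in> R) = (B @ [b]) ! i)
      \<longleftrightarrow> (\<forall>i<m. (i \<in> R) = A ! i \<and> (n - i \<in> R) = B ! i)" for R
      using m(2) by (simp add: nth_append m_def)
    moreover have "(A @ [a]) ! m = a" "(B @ [b]) ! m = b"
      using m(2) by (simp_all add: nth_append m_def)
    ultimately have "agree n (A @ [a]) (B @ [b]) = {R \<in> agree n A B. (m \<in> R) = a \<and> (n - m \<in> R) = b}"
      unfolding agree_def by (simp add: m_def[symmetric] All_less_Suc conj_ac del: nth_append_length)
    then show ?thesis by blast
  qed
  have cardX: "card ?X = card (?Y False False) + card (?Y False True) + card (?Y True False) + card (?Y True True)"
    unfolding Y by (rule card_split_4) simp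
  have cardY: "real (card (?Y a b)) = 2 ^ (n - 1 - 2 * m) * cover_prob d (A @ [a]) (B @ [b])" for a b
    using Suc.IH[of "A @ [a]" "B @ [b]"] m by (simp add: m_def)
  \<comment> \<open>This rules out truncation in the natural subtractions; fixing one more bit at
    each end costs a factor 4.\<close>
  have "2 * m + 2 \<le> n + 1" using m by simp
  then have "n + 1 - 2 * m = Suc (Suc (n - 1 - 2 * m))" by arith
  then have "(2::real) ^ (n + 1 - 2 * m) = 4 * 2 ^ (n - 1 - 2 * m)" by simp
  then show ?case
    unfolding m_def[symmetric] cardX of_nat_add cardY cover_prob.simps by (simp add: distrib_left)
qed

corollary card_long_differences:
  assumes "2 * M \<le> n + 1"
  shows "real (card {R. R \<subseteq> {..n} \<and> has_long_differences n M R}) = 2 ^ (n + 1) * cover_prob M [] []"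
  using card_agree_long_differences[of "[]" "[]" M n] assms by (simp add: agree_def)

text \<open>The pairs \<open>{x, f x}\<close> are disjoint, and each excludes one of its four
  membership patterns, so a fraction \<open>3/4\<close> survives per pair. Multiplying out keeps the
  claim in the naturals.\<close>

lemma card_independent_of_matching_le:
  assumes "finite X" "finite V" "X \<subseteq> V" "f ` X \<subseteq> V" "X \<inter> f ` X = {}" "inj_on f X"
  shows "4 ^ card X * card {R. R \<subseteq> V \<and> (\<forall>x\<in>X. \<not> (x \<in> R \<and> f x \<in> R))}
    \<le> 2 ^ card V * 3 ^ card X"
  using assms
proof (induction X arbitrary: V rule: finite_induct)
  case empty
  then show ?case by (simp add: Pow_def[symmetric] card_Pow)
next
  case (insert x X)
  define V' where "V' = V - {x, f x}"
  let ?Y = "{R. R \<subseteq> V \<and> (\<forall>y\<in>insert x X. \<not> (y \<in> R \<and> f y \<in> R))}"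
  define Z where "Z = {R. R \<subseteq> V' \<and> (\<forall>y\<in>X. \<not> (y \<in> R \<and> f y \<in> R))}"
  have "finite V'" using insert.prems by (simp add: V'_def)
  then have finZ: "finite Z" by (simp add: Z_def)
  have neq: "x \<noteq> f x" using insert.prems by auto
  have IH: "4 ^ card X * card Z \<le> 2 ^ card V' * 3 ^ card X"
    using insert.prems insert.hyps unfolding Z_def by (intro insert.IH) (auto simp: V'_def inj_on_def)
  have "card V = card V' + 2"
    using insert.prems neq unfolding V'_def
    by (subst card_Diff_subset) (auto simp: card_insert_if dest: card_mono[of V "{x, f x}"])
  \<comment> \<open>Deleting both endpoints lands in \<open>Z\<close>, and at most one of them can
    be put back.\<close>
  have "?Y \<subseteq> Z \<union> (insert x ` Z \<union> insert (f x) ` Z)"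
  proof
    fix R assume R: "R \<in> ?Y"
    then have Z: "R - {x, f x} \<in> Z" by (auto simp: Z_def V'_def)
    have "R = R - {x, f x} \<or> R = insert x (R - {x, f x}) \<or> R = insert (f x) (R - {x, f x})"
      using R by (cases "x \<in> R"; cases "f x \<in> R") auto
    then show "R \<in> Z \<union> (insert x ` Z \<union> insert (f x) ` Z)"
      using Z by (metis UnI1 UnI2 imageI)
  qed
  then have "card ?Y \<le> card (Z \<union> (insert x ` Z \<union> insert (f x) ` Z))"
    using finZ by (intro card_mono) auto
  also have "\<dots> \<le> card Z + (card (insert x ` Z) + card (insert (f x) ` Z))"
    by (intro order.trans[OF card_Un_le] add_left_mono card_Un_le)
  also have "\<dots> \<le> 3 * card Z"
    using card_image_le[OF finZ, of "insert x"] card_image_le[OF finZ, of "insert (f x)"] by linarith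
  finally have "card ?Y \<le> 3 * card Z" .
  then have "4 ^ card (insert x X) * card ?Y \<le> 12 * (4 ^ card X * card Z)"
    using insert.hyps by simp
  also have "\<dots> \<le> 12 * (2 ^ card V' * 3 ^ card X)"
    using IH by simp
  also have "\<dots> = 2 ^ card V * 3 ^ card (insert x X)"
    using insert.hyps \<open>card V = card V' + 2\<close> by simp
  finally show ?case .
qed

text \<open>With d = n - k, the pairs x, x + d with x div d even are disjoint, and they are at least half of
  all pairs at distance d.\<close>

lemma card_missing_difference_le:
  assumes "k \<le> n"
  shows "real (card {R. R \<subseteq> {..n} \<and> (\<forall>x. \<not> (x \<in> R \<and> x + (n - k) \<in> R))})
       \<le> 2 ^ (n + 1) * sqrt (3/4) ^ (k + 1)"
proof (cases "k = n")
  case True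
  have "{R. R \<subseteq> {..n} \<and> (\<forall>x. \<not> (x \<in> R \<and> x + (n - k) \<in> R))} = {{}}"
    using True by auto
  \<comment> \<open>\<open>2 * sqrt (3/4)\<close> is \<open>sqrt 3\<close>, so the bound is at least
    1, the number of sets in this case.\<close>
  moreover have "(1::real) \<le> (2 * sqrt (3/4)) ^ (n + 1)"
    by (intro one_le_power) (simp add: real_sqrt_divide)
  ultimately show ?thesis using True by (simp only: power_mult_distrib) simp
next
  case False
  define d where "d = n - k"
  have d: "d > 0" "n - d = k" "d \<le> n" using False assms by (auto simp: d_def)
  define X where "X = {x. x + d \<le> n \<and> even (x div d)}"
  define X' where "X' = {x. x + d \<le> n \<and> odd (x div d)}"
  have fin: "finite X" "finite X'"
    by (rule finite_subset[of _ "{..n}"]; force simp: X_def X'_def)+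
  \<comment> \<open>Shifting down by \<open>d\<close> sends odd blocks injectively into even ones,
    so \<open>X\<close> holds at least half of the \<open>k + 1\<close> possible lower
    endpoints.\<close>
  have "(\<lambda>x. x - d) ` X' \<subseteq> X"
  proof
    fix y assume "y \<in> (\<lambda>x. x - d) ` X'"
    then obtain x where x: "x \<in> X'" "y = x - d" by auto
    then have "x \<ge> d" using d by (cases "x < d") (auto simp: X'_def)
    then have "x div d = Suc (y div d)" using x d by (metis le_div_geq not_le)
    then show "y \<in> X" using x \<open>x \<ge> d\<close> by (auto simp: X_def X'_def)
  qed
  moreover have "inj_on (\<lambda>x. x - d) X'"
  proof (rule inj_onI)
    fix x y assume "x \<in> X'" "y \<in> X'" "x - d = y - d"
    moreover have "z \<ge> d" if "z \<in> X'" for z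
      using that d by (cases "z < d") (auto simp: X'_def)
    ultimately show "x = y" by (metis le_add_diff_inverse2)
  qed
  ultimately have "card X' \<le> card X"
    using fin by (metis card_image card_mono)
  moreover have "{..k} = X \<union> X'" using d by (auto simp: X_def X'_def)
  then have "k + 1 \<le> card X + card X'"
    by (metis Suc_eq_plus1 card_Un_le card_atMost)
  ultimately have cardX: "k + 1 \<le> 2 * card X" by linarith
  have "X \<inter> (\<lambda>x. x + d) ` X = {}"
    using d by (auto simp: X_def)
  then have "4 ^ card X * card {R. R \<subseteq> {..n} \<and> (\<forall>x\<in>X. \<not> (x \<in> R \<and> x + d \<in> R))}
      \<le> 2 ^ card {..n} * 3 ^ card X"
    using fin by (intro card_independent_of_matching_le) (auto simp: X_def)
  moreover have "card {R. R \<subseteq> {..n} \<and> (\<forall>x. \<not> (x \<in> R \<and> x + d \<in> R))}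
     \<le> card {R. R \<subseteq> {..n} \<and> (\<forall>x\<in>X. \<not> (x \<in> R \<and> x + d \<in> R))}"
    by (intro card_mono) auto
  ultimately have "4 ^ card X * card {R. R \<subseteq> {..n} \<and> (\<forall>x. \<not> (x \<in> R \<and> x + d \<in> R))}
      \<le> 2 ^ (n + 1) * 3 ^ card X"
    by (simp add: order.trans[OF mult_left_mono])
  then have "real (4 ^ card X * card {R. R \<subseteq> {..n} \<and> (\<forall>x. \<not> (x \<in> R \<and> x + d \<in> R))})
      \<le> real (2 ^ (n + 1) * 3 ^ card X)"
    by (rule of_nat_mono)
  then have "real (card {R. R \<subseteq> {..n} \<and> (\<forall>x. \<not> (x \<in> R \<and> x + d \<in> R))})
      \<le> 2 ^ (n + 1) * (3/4) ^ card X"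
    by (simp add: field_simps)
  \<comment> \<open>The square root absorbs the loss of half of the pairs, since only
    \<open>k + 1 \<le> 2 * card X\<close> is known.\<close>
  also have "(3/4 :: real) ^ card X = sqrt (3/4) ^ (2 * card X)"
    by (simp add: power_mult)
  also have "\<dots> \<le> sqrt (3/4) ^ (k + 1)"
    using cardX by (intro power_decreasing) auto
  finally show ?thesis by (simp add: d_def)
qed

section \<open>Complete rulers and their limiting density\<close>

definition spans_all :: "nat \<Rightarrow> nat set \<Rightarrow> bool" where
  "spans_all n R \<longleftrightarrow> R \<subseteq> {..n} \<and> (\<forall>d\<le>n. \<exists>x. x \<in> R \<and> x + d \<in> R)"

text \<open>Rulers contain no negative numbers, so \<open>int\<close> maps the sets of naturals in
  question bijectively onto them.\<close>

lemma num_complete_rulers_eq: "num_complete_rulers n = card {R. spans_all n R}"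
proof -
  have *: "complete_ruler n (int ` R) \<longleftrightarrow> spans_all n R" for R
  proof -
    have "(\<forall>z\<in>{0..int n}. z \<in> diff_set (int ` R)) \<longleftrightarrow> (\<forall>d\<le>n. int d \<in> diff_set (int ` R))"
    proof (intro iffI ballI)
      fix z assume *: "\<forall>d\<le>n. int d \<in> diff_set (int ` R)" and z: "z \<in> {0..int n}"
      then have "nat z \<le> n" "int (nat z) = z" by auto
      with * show "z \<in> diff_set (int ` R)" by metis
    qed simp
    moreover have "int d \<in> diff_set (int ` R) \<longleftrightarrow> (\<exists>x. x \<in> R \<and> x + d \<in> R)" for d
    proof
      assume "int d \<in> diff_set (int ` R)"
      then obtain x y where "int d = int x - int y" "x \<in> R" "y \<in> R"
        unfolding diff_set_def by auto
      moreover from this(1) have "x = y + d" by linarith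
      ultimately show "\<exists>x. x \<in> R \<and> x + d \<in> R" by blast
    next
      assume "\<exists>x. x \<in> R \<and> x + d \<in> R"
      then obtain x where "x \<in> R" "x + d \<in> R" by blast
      moreover have "int d = int (x + d) - int x" by simp
      ultimately show "int d \<in> diff_set (int ` R)" unfolding diff_set_def by blast
    qed
    moreover have "ruler n (int ` R) \<longleftrightarrow> R \<subseteq> {..n}"
      unfolding ruler_def by auto
    ultimately show ?thesis
      unfolding complete_ruler_def spans_all_def subset_iff by blast
  qed
  have "{R. complete_ruler n R} = image int ` {R. spans_all n R}"
  proof (intro equalityI subsetI)
    fix R assume R: "R \<in> {R. complete_ruler n R}"
    then have "R \<subseteq> {0..int n}" by (simp add: complete_ruler_def ruler_def)
    then have eq: "R = int ` (nat ` R)" by (force simp: image_image)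
    then have "spans_all n (nat ` R)" using R *[of "nat ` R"] by (metis mem_Collect_eq)
    then show "R \<in> image int ` {R. spans_all n R}"
      using eq by (metis image_eqI mem_Collect_eq)
  qed (use * in auto)
  then show ?thesis
    unfolding num_complete_rulers_def by (simp add: card_image inj_on_def inj_image_eq_iff)
qed

lemma spans_all_imp_long_differences:
  assumes "spans_all n R" "M \<le> n + 1"
  shows "has_long_differences n M R"
  unfolding has_long_differences_def
proof (intro allI impI)
  fix k assume k: "k < M"
  then obtain x where x: "x \<in> R" "x + (n - k) \<in> R"
    using assms unfolding spans_all_def by (meson diff_le_self)
  then have "x + (n - k) \<le> n" using assms unfolding spans_all_def by auto
  \<comment> \<open>The upper member stays within \<open>n\<close>, which forces
    \<open>x \<le> k\<close>; so \<open>x\<close> itself serves as \<open>i\<close>.\<close>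
  then have "x \<le> k" "n - (k - x) = x + (n - k)" using k assms(2) by auto
  then show "\<exists>i\<le>k. i \<in> R \<and> n - (k - i) \<in> R" using x by metis
qed

lemma num_complete_rulers_le:
  assumes "2 * M \<le> n + 1"
  shows "real (num_complete_rulers n) \<le> 2 ^ (n + 1) * cover_prob M [] []"
proof -
  have "card {R. spans_all n R} \<le> card {R. R \<subseteq> {..n} \<and> has_long_differences n M R}"
    using assms by (intro card_mono)
      (auto simp: spans_all_imp_long_differences spans_all_def)
  then show ?thesis
    using card_long_differences[OF assms] by (simp add: num_complete_rulers_eq)
qed

text \<open>A set with the \<open>M\<close> longest differences can fail only by missing some
  \<open>n - k\<close> with \<open>k \<ge> M\<close>. The union bound over these \<open>k\<close> is
  a geometric tail of ratio \<open>sqrt (3/4)\<close>.\<close>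

lemma num_complete_rulers_ge:
  assumes "2 * M \<le> n + 1"
  shows "2 ^ (n + 1) * (cover_prob M [] [] - sqrt (3/4) ^ (M + 1) / (1 - sqrt (3/4)))
       \<le> real (num_complete_rulers n)"
proof -
  define r :: real where "r = sqrt (3/4)"
  have r: "0 \<le> r" "r < 1" by (simp_all add: r_def)
  define miss where "miss k = {R. R \<subseteq> {..n} \<and> (\<forall>x. \<not> (x \<in> R \<and> x + (n - k) \<in> R))}" for k
  have fin: "finite {R. spans_all n R}"
    by (rule finite_subset[of _ "Pow {..n}"]) (auto simp: spans_all_def)
  have "R \<in> {R. spans_all n R} \<union> (\<Union>k\<in>{M..n}. miss k)"
    if R: "R \<subseteq> {..n}" "has_long_differences n M R" for R
  proof (cases "spans_all n R")
    case False
    then obtain d where d: "d \<le> n" "\<And>x. \<not> (x \<in> R \<and> x + d \<in> R)"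
      using R by (auto simp: spans_all_def)
    have "n - d \<ge> M"
    proof (rule ccontr)
      assume "\<not> n - d \<ge> M"
      then obtain i where i: "i \<le> n - d" "i \<in> R" "n - (n - d - i) \<in> R"
        using R(2) unfolding has_long_differences_def by (meson not_le)
      then have "n - (n - d - i) = i + d" using d(1) by arith
      with i d show False by metis
    qed
    moreover have "R \<in> miss (n - d)" using R d by (simp add: miss_def)
    ultimately show ?thesis by auto
  qed simp
  then have "{R. R \<subseteq> {..n} \<and> has_long_differences n M R}
      \<subseteq> {R. spans_all n R} \<union> (\<Union>k\<in>{M..n}. miss k)" by blast
  then have "card {R. R \<subseteq> {..n} \<and> has_long_differences n M R}
      \<le> card ({R. spans_all n R} \<union> (\<Union>k\<in>{M..n}. miss k))"
    using fin by (intro card_mono) (auto simp: miss_def)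
  also have "\<dots> \<le> card {R. spans_all n R} + (\<Sum>k\<in>{M..n}. card (miss k))"
    by (intro order.trans[OF card_Un_le] add_left_mono card_UN_le) simp
  finally have "2 ^ (n + 1) * cover_prob M [] []
      \<le> real (num_complete_rulers n) + (\<Sum>k\<in>{M..n}. real (card (miss k)))"
    using card_long_differences[OF assms] by (simp add: num_complete_rulers_eq flip: of_nat_sum of_nat_add)
  also have "(\<Sum>k\<in>{M..n}. real (card (miss k))) \<le> (\<Sum>k\<in>{M..n}. 2 ^ (n + 1) * r ^ (k + 1))"
    unfolding miss_def r_def by (intro sum_mono card_missing_difference_le) auto
  also have "\<dots> = 2 ^ (n + 1) * (r * (\<Sum>k\<in>{M..n}. r ^ k))"
    by (simp add: sum_distrib_left mult.assoc)
  finally have main: "2 ^ (n + 1) * cover_prob M [] []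
      \<le> real (num_complete_rulers n) + 2 ^ (n + 1) * (r * (\<Sum>k\<in>{M..n}. r ^ k))" by simp
  have "(\<Sum>k\<in>{M..n}. r ^ k) = (r ^ M - r ^ (n + 1)) / (1 - r)"
    using assms r by (subst sum_gp) auto
  also have "\<dots> \<le> r ^ M / (1 - r)"
    using r by (intro divide_right_mono) auto
  finally have "2 ^ (n + 1) * (r * (\<Sum>k\<in>{M..n}. r ^ k)) \<le> 2 ^ (n + 1) * (r * (r ^ M / (1 - r)))"
    using r by (intro mult_left_mono) auto
  also have "\<dots> = 2 ^ (n + 1) * (r ^ (M + 1) / (1 - r))" by simp
  finally show ?thesis
    unfolding r_def[symmetric] right_diff_distrib using main by linarith
qed

lemma num_complete_rulers_tendsto:
  obtains p where "(\<lambda>d. cover_prob d [] []) \<longlonglongrightarrow> p"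
    "(\<lambda>n. real (num_complete_rulers n) / 2 ^ n) \<longlonglongrightarrow> 2 * p"
proof -
  define r :: real where "r = sqrt (3/4)"
  have r: "0 \<le> r" "r < 1" by (simp_all add: r_def)
  define g where "g d = cover_prob d [] []" for d
  have "decseq g"
    unfolding g_def by (intro decseq_SucI cover_prob_Suc_le) simp
  then obtain p where p: "g \<longlonglongrightarrow> p"
    using decseq_convergent[of g 0] cover_prob_nonneg unfolding g_def by metis
  \<comment> \<open>The largest admissible \<open>M\<close>. It tends to infinity, so the tail in
    the lower bound vanishes and both bounds meet.\<close>
  define h where "h n = (n + 1) div 2" for n :: nat
  have h: "filterlim h at_top at_top"
    unfolding filterlim_at_top eventually_sequentially h_def
  proof
    fix Z :: nat
    show "\<exists>N. \<forall>n\<ge>N. Z \<le> (n + 1) div 2" by (rule exI[of _ "2 * Z"]) auto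
  qed
  have gh: "(\<lambda>n. g (h n)) \<longlonglongrightarrow> p" by (rule filterlim_compose[OF p h])
  have "(\<lambda>n. r ^ n) \<longlonglongrightarrow> 0" using r by (intro LIMSEQ_power_zero) simp
  then have "(\<lambda>n. r ^ h n) \<longlonglongrightarrow> 0" by (rule filterlim_compose[OF _ h])
  then have "(\<lambda>n. 2 * (g (h n) - r ^ h n * r / (1 - r))) \<longlonglongrightarrow> 2 * (p - 0 * r / (1 - r))"
    using r by (intro tendsto_intros gh) auto
  then have lower: "(\<lambda>n. 2 * (g (h n) - r ^ (h n + 1) / (1 - r))) \<longlonglongrightarrow> 2 * p"
    by (simp add: mult.commute)
  have upper: "(\<lambda>n. 2 * g (h n)) \<longlonglongrightarrow> 2 * p"
    by (intro tendsto_intros gh)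
  have scale: "2 ^ (n + 1) * x \<le> y \<Longrightarrow> 2 * x \<le> y / 2 ^ n" "y \<le> 2 ^ (n + 1) * x \<Longrightarrow> y / 2 ^ n \<le> 2 * x"
    for x y :: real and n by (simp_all add: pos_le_divide_eq pos_divide_le_eq mult_ac)
  have "2 * h n \<le> n + 1" for n by (simp add: h_def)
  note bounds = num_complete_rulers_ge[OF this] num_complete_rulers_le[OF this]
  have "(\<lambda>n. real (num_complete_rulers n) / 2 ^ n) \<longlonglongrightarrow> 2 * p"
  proof (rule tendsto_sandwich[OF _ _ lower upper])
    show "\<forall>\<^sub>F n in sequentially. 2 * (g (h n) - r ^ (h n + 1) / (1 - r))
        \<le> real (num_complete_rulers n) / 2 ^ n"
      using scale(1)[OF bounds(1)] unfolding g_def r_def by (intro always_eventually allI)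
    show "\<forall>\<^sub>F n in sequentially. real (num_complete_rulers n) / 2 ^ n \<le> 2 * g (h n)"
      using scale(2)[OF bounds(2)] unfolding g_def by (intro always_eventually allI)
  qed
  with p show ?thesis using that unfolding g_def by blast
qed

section \<open>Union bound\<close>

text \<open>Bits that are not yet revealed get the value 1/2. The product \<open>avoid\<close> is affine in each bit, so this
  computes conditional probabilities exactly.\<close>

definition bitval :: "bool list \<Rightarrow> nat \<Rightarrow> real" where
  "bitval A i = (if i < length A then of_bool (A ! i) else 1/2)"

definition avoid :: "nat \<Rightarrow> (nat \<Rightarrow> real) \<Rightarrow> (nat \<Rightarrow> real) \<Rightarrow> real" where
  "avoid k p q = (\<Prod>i\<le>k. 1 - p i * q (k - i))"

lemma avoid_commute: "avoid k p q = avoid k q p"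
  unfolding avoid_def
  by (rule prod.reindex_bij_witness[of _ "\<lambda>i. k - i" "\<lambda>i. k - i"]) auto

lemma avoid_midpoint:
  assumes "p x = 1/2"
  shows "avoid k p q = (avoid k (p(x := 0)) q + avoid k (p(x := 1)) q) / 2"
proof (cases "x \<le> k")
  case True
  have *: "avoid k (p(x := c)) q = (1 - c * q (k - x)) * (\<Prod>i\<in>{..k} - {x}. 1 - p i * q (k - i))" for c
    unfolding avoid_def using True
    by (subst prod.remove[of _ x]) (auto intro!: prod.cong)
  have "p(x := 1/2) = p" using assms by auto
  then show ?thesis
    using *[of 0] *[of 1] *[of "1/2"] by (simp add: field_simps)
next
  case False
  then have "avoid k (p(x := c)) q = avoid k p q" for c
    unfolding avoid_def by (intro prod.cong) auto
  then show ?thesis by simp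
qed

definition miss_prob :: "nat \<Rightarrow> bool list \<Rightarrow> bool list \<Rightarrow> real" where
  "miss_prob k A B = avoid k (bitval A) (bitval B)"

lemma bitval_snoc: "bitval (A @ [a]) = (bitval A)(length A := of_bool a)"
  by (rule ext) (auto simp: bitval_def nth_append)

text \<open>\<open>miss_prob\<close> obeys the averaging recursion of \<open>cover_prob\<close>, so
  linear inequalities between the two need checking only once all bits are revealed.\<close>

lemma miss_prob_step:
  "miss_prob k A B =
    (miss_prob k (A @ [False]) (B @ [False]) + miss_prob k (A @ [False]) (B @ [True])
   + miss_prob k (A @ [True]) (B @ [False]) + miss_prob k (A @ [True]) (B @ [True])) / 4"
proof -
  have A: "avoid k (bitval A) q = (avoid k (bitval (A @ [False])) q + avoid k (bitval (A @ [True])) q) / 2"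
    for A q by (subst avoid_midpoint[of _ "length A"]) (simp_all add: bitval_snoc, simp add: bitval_def)
  have B: "avoid k q (bitval B) = (avoid k q (bitval (B @ [False])) + avoid k q (bitval (B @ [True]))) / 2"
    for q B by (simp only: avoid_commute[of k q] A[of B])
  show ?thesis unfolding miss_prob_def
    by (subst A, subst (1 2) B) (simp add: field_simps)
qed

lemma miss_prob_nonneg: "0 \<le> miss_prob k A B"
  unfolding miss_prob_def avoid_def
proof (intro prod_nonneg ballI)
  fix i
  have "0 \<le> bitval X j" "bitval X j \<le> 1" for X j by (auto simp: bitval_def)
  then show "0 \<le> 1 - bitval A i * bitval B (k - i)" by (simp add: mult_le_one)
qed

lemma prod_zero_one:
  assumes "finite I"
  shows "(\<Prod>i\<in>I. 1 - of_bool (P i) * of_bool (Q i) :: real) = of_bool (\<forall>i\<in>I. \<not> (P i \<and> Q i))"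
  using assms by induction auto

lemma miss_prob_decided:
  assumes "k < length A" "length A = length B"
  shows "miss_prob k A B = of_bool (\<not> covered A B k)"
proof -
  have "miss_prob k A B = (\<Prod>i\<le>k. 1 - of_bool (A ! i) * of_bool (B ! (k - i)))"
    unfolding miss_prob_def avoid_def using assms by (intro prod.cong) (auto simp: bitval_def)
  also have "\<dots> = of_bool (\<forall>i\<in>{..k}. \<not> (A ! i \<and> B ! (k - i)))" by (rule prod_zero_one) simp
  also have "\<dots> = of_bool (\<not> covered A B k)"
    using assms by (auto simp: covered_def)
  finally show ?thesis .
qed

text \<open>Both sides average alike, which reduces the claim to \<open>d = 0\<close>. There each
  term is 0 or 1, and a missed number makes the left side nonpositive.\<close>

lemma cover_prob_ge_union_bound:
  assumes "length A = length B"
  shows "1 - (\<Sum>k<length A + d. miss_prob k A B) \<le> cover_prob d A B"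
  using assms
proof (induction d A B rule: cover_prob.induct)
  case (1 A B)
  show ?case
  proof (cases "\<forall>k<length A. covered A B k")
    case True
    then show ?thesis by (auto intro!: sum_nonneg miss_prob_nonneg)
  next
    case False
    then obtain k where k: "k < length A" "\<not> covered A B k" by blast
    have "miss_prob k A B \<le> (\<Sum>k<length A. miss_prob k A B)"
      using k by (intro member_le_sum miss_prob_nonneg) auto
    then show ?thesis using k 1 by (auto simp: miss_prob_decided)
  qed
next
  case (2 d A B)
  have len: "length (A @ [a]) = length (B @ [b])" for a b using 2 by simp
  note IH = 2(1-4)[OF len]
  have "(\<Sum>k<length A + Suc d. miss_prob k A B) =
    ((\<Sum>k<length A + Suc d. miss_prob k (A @ [False]) (B @ [False]))
    + (\<Sum>k<length A + Suc d. miss_prob k (A @ [False]) (B @ [True]))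
    + (\<Sum>k<length A + Suc d. miss_prob k (A @ [True]) (B @ [False]))
    + (\<Sum>k<length A + Suc d. miss_prob k (A @ [True]) (B @ [True]))) / 4"
    by (subst miss_prob_step) (simp add: sum.distrib flip: sum_divide_distrib)
  then show ?case using IH by simp
qed

section \<open>Bonferroni bound\<close>

definition bit_at :: "bool list \<Rightarrow> nat \<Rightarrow> bool" where
  "bit_at A i \<longleftrightarrow> i < length A \<and> A ! i"

definition half_if :: "bool \<Rightarrow> real" where
  "half_if b = (if b then 1/2 else 1)"

lemma half_if_simps [simp]: "half_if True = 1/2" "half_if False = 1"
  by (simp_all add: half_if_def)

text \<open>Position \<open>k - x\<close> of \<open>A\<close> is one, so a one at \<open>x\<close>
  in the other string would produce \<open>k\<close>. That bit must vanish, at a cost of 1/2 paid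
  once however many \<open>k\<close> in \<open>T\<close> require it; this is how
  \<open>joint_miss\<close> accounts for dependence.\<close>

definition hit :: "nat set \<Rightarrow> bool list \<Rightarrow> nat \<Rightarrow> bool" where
  "hit T A x \<longleftrightarrow> (\<exists>k\<in>T. x \<le> k \<and> bit_at A (k - x))"

text \<open>The conditional probability that no element of T is a sum, valid if T lies below N and N is at most
  twice the prefix length: then each pair of bits adding up to an element of T has a revealed member,
  so an element of T is missed iff certain unrevealed bits vanish.\<close>

definition joint_miss :: "nat \<Rightarrow> nat set \<Rightarrow> bool list \<Rightarrow> bool list \<Rightarrow> real" where
  "joint_miss N T A B = of_bool (\<forall>k\<in>T. \<not> covered A B k) *
     (\<Prod>x\<in>{length A..<N}. half_if (hit T A x) * half_if (hit T B x))"

text \<open>Below \<open>2 * length A\<close> the two new bits cannot be added to each other; each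
  combines only with revealed bits.\<close>

lemma covered_snoc:
  assumes "length A = length B" "k < 2 * length A"
  shows "covered (A @ [a]) (B @ [b]) k \<longleftrightarrow> covered A B k
    \<or> length A \<le> k \<and> (a \<and> bit_at B (k - length A) \<or> b \<and> bit_at A (k - length A))"
    (is "?L \<longleftrightarrow> ?R")
proof
  assume ?L
  then obtain i where i: "i \<le> k" "i < length A + 1" "k - i < length A + 1"
    "(A @ [a]) ! i" "(B @ [b]) ! (k - i)"
    unfolding covered_def using assms by auto
  consider "i < length A" "k - i < length A" | "i = length A" | "k - i = length A" using i by linarith
  then show ?R
  proof cases
    case 1
    then show ?thesis using i assms unfolding covered_def by (auto simp: nth_append)
  next
    case 2
    then have "k - i < length B" using assms by linarith
    then show ?thesis using i 2 assms by (auto simp: nth_append bit_at_def)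
  next
    case 3
    then have "i < length A" "i = k - length A" "length A \<le> k" using assms i by auto
    then show ?thesis using i 3 assms by (auto simp: nth_append bit_at_def)
  qed
next
  assume ?R
  then consider "covered A B k" | "length A \<le> k" "a" "bit_at B (k - length A)"
    | "length A \<le> k" "b" "bit_at A (k - length A)" by blast
  then show ?L
  proof cases
    case 1
    then obtain i where "i \<le> k" "i < length A" "k - i < length B" "A ! i" "B ! (k - i)"
      unfolding covered_def by blast
    then show ?thesis unfolding covered_def by (intro exI[of _ i]) (simp add: nth_append)
  next
    case 2
    then show ?thesis unfolding covered_def
      by (intro exI[of _ "length A"]) (simp add: nth_append bit_at_def)
  next
    case 3
    then show ?thesis unfolding covered_def using assms
      by (intro exI[of _ "k - length A"]) (simp add: nth_append bit_at_def)
  qed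
qed

lemma joint_miss_step:
  assumes len: "length A = length B" and T: "T \<subseteq> {..<N}" and N: "N \<le> 2 * length A"
  shows "joint_miss N T A B =
    (joint_miss N T (A @ [False]) (B @ [False]) + joint_miss N T (A @ [False]) (B @ [True])
   + joint_miss N T (A @ [True]) (B @ [False]) + joint_miss N T (A @ [True]) (B @ [True])) / 4"
proof -
  define l where "l = length A"
  define P where "P = (\<Prod>x\<in>{Suc l..<N}. half_if (hit T A x) * half_if (hit T B x))"
  define U where "U \<longleftrightarrow> (\<forall>k\<in>T. \<not> covered A B k)"
  have Tk: "k < 2 * l" if "k \<in> T" for k using that T N by (auto simp: l_def)
  \<comment> \<open>Elements of \<open>T\<close> lie below \<open>2 * l\<close>, so positions beyond
    \<open>l\<close> are matched with bits before \<open>l\<close>, never with the new ones.\<close>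
  have hit_snoc: "hit T (X @ [c]) x \<longleftrightarrow> hit T X x" if "Suc l \<le> x" "length X = l" for X c x
    unfolding hit_def bit_at_def
  proof (intro bex_cong refl)
    fix k assume "k \<in> T"
    then have "x \<le> k \<Longrightarrow> k - x < l" using Tk[of k] that by linarith
    then show "(x \<le> k \<and> k - x < length (X @ [c]) \<and> (X @ [c]) ! (k - x)) =
      (x \<le> k \<and> k - x < length X \<and> X ! (k - x))" using that by (auto simp: nth_append)
  qed
  have new: "joint_miss N T (A @ [a]) (B @ [b]) =
     of_bool U * of_bool (\<not> (a \<and> hit T B l)) * of_bool (\<not> (b \<and> hit T A l)) * P" for a b
  proof -
    have "(\<forall>k\<in>T. \<not> covered (A @ [a]) (B @ [b]) k) \<longleftrightarrow>
        U \<and> \<not> (a \<and> hit T B l) \<and> \<not> (b \<and> hit T A l)"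
      using covered_snoc[OF len] Tk unfolding U_def hit_def l_def by blast
    moreover have "(\<Prod>x\<in>{length (A @ [a])..<N}. half_if (hit T (A @ [a]) x) * half_if (hit T (B @ [b]) x)) = P"
      unfolding P_def using hit_snoc len by (intro prod.cong) (auto simp: l_def)
    ultimately show ?thesis unfolding joint_miss_def by (simp only: of_bool_conj mult.assoc)
  qed
  have old: "joint_miss N T A B = of_bool U * (half_if (hit T A l) * half_if (hit T B l)) * P"
  proof (cases "l < N")
    case True
    then show ?thesis unfolding joint_miss_def U_def P_def l_def
      by (subst prod.atLeast_Suc_lessThan) (simp_all add: mult.assoc)
  next
    case False
    \<comment> \<open>With \<open>N \<le> l\<close> no element of \<open>T\<close> reaches position
      \<open>l\<close>, so the factor split off is 1.\<close>
    then have "\<not> hit T A l" "\<not> hit T B l" using T by (auto simp: hit_def)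
    then show ?thesis using False unfolding joint_miss_def U_def P_def l_def by simp
  qed
  show ?thesis unfolding new old
    by (cases "hit T A l"; cases "hit T B l") (simp_all add: field_simps)
qed

lemma joint_miss_decided:
  assumes "N \<le> length A"
  shows "joint_miss N T A B = of_bool (\<forall>k\<in>T. \<not> covered A B k)"
  using assms by (simp add: joint_miss_def)

lemma sum_pairs_zero_one:
  fixes T :: "nat set"
  assumes "finite T"
  shows "(\<Sum>k\<in>T. \<Sum>j\<in>{j\<in>T. j < k}. of_bool (P j \<and> P k) :: real)
     = real (card {k \<in> T. P k}) * (real (card {k \<in> T. P k}) - 1) / 2"
  using assms
proof (induction T rule: finite_linorder_max_induct)
  case (insert m T)
  have m: "m \<notin> T" using insert by auto
  have "{j \<in> insert m T. j < m} = T" using insert by auto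
  moreover have "{j \<in> insert m T. j < k} = {j \<in> T. j < k}" if "k \<in> T" for k
    using insert that by auto
  ultimately have "(\<Sum>k\<in>insert m T. \<Sum>j\<in>{j\<in>insert m T. j < k}. of_bool (P j \<and> P k) :: real)
     = (\<Sum>j\<in>T. of_bool (P j \<and> P m)) + (\<Sum>k\<in>T. \<Sum>j\<in>{j\<in>T. j < k}. of_bool (P j \<and> P k))"
    using insert m by simp
  also have "(\<Sum>j\<in>T. of_bool (P j \<and> P m) :: real) = of_bool (P m) * real (card {k \<in> T. P k})"
    using insert by (cases "P m") (simp_all add: sum.inter_filter[symmetric] of_bool_def)
  also have "{k \<in> insert m T. P k} = (if P m then insert m {k \<in> T. P k} else {k \<in> T. P k})" by auto
  then have "card {k \<in> insert m T. P k} = of_bool (P m) + card {k \<in> T. P k}"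
    using insert m by auto
  ultimately show ?case using insert.IH by (cases "P m") (simp_all add: field_simps)
qed simp

text \<open>Averaging again reduces the claim to \<open>d = 0\<close>, where
  \<open>N \<le> length A + d\<close> makes all of \<open>T\<close> decided. With \<open>t\<close>
  misses in \<open>T\<close> the right side is \<open>1 - t + t * (t - 1) / 2\<close>, which is 1
  for \<open>t = 0\<close> and never negative.\<close>

lemma cover_prob_le_bonferroni:
  assumes "length A = length B" "T \<subseteq> {..<N}" "N \<le> 2 * length A" "N \<le> length A + d"
  shows "cover_prob d A B \<le> 1 - (\<Sum>k\<in>T. miss_prob k A B)
    + (\<Sum>k\<in>T. \<Sum>j\<in>{j\<in>T. j < k}. joint_miss N {j, k} A B)"
  using assms
proof (induction d A B rule: cover_prob.induct)
  case (1 A B)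
  have fin: "finite T" using 1 by (auto intro: finite_subset)
  let ?t = "card {k \<in> T. \<not> covered A B k}"
  have "(\<Sum>k\<in>T. miss_prob k A B) = (\<Sum>k\<in>T. of_bool (\<not> covered A B k))"
    using 1 by (intro sum.cong miss_prob_decided) auto
  also have "\<dots> = real ?t"
    using fin by (simp add: sum.inter_filter[symmetric] of_bool_def)
  finally have s: "(\<Sum>k\<in>T. miss_prob k A B) = real ?t" .
  have "(\<Sum>k\<in>T. \<Sum>j\<in>{j\<in>T. j < k}. joint_miss N {j, k} A B)
     = (\<Sum>k\<in>T. \<Sum>j\<in>{j\<in>T. j < k}. of_bool (\<not> covered A B j \<and> \<not> covered A B k))"
    using 1 by (simp add: joint_miss_decided)
  also have "\<dots> = real ?t * (real ?t - 1) / 2" by (rule sum_pairs_zero_one[OF fin])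
  finally have p: "(\<Sum>k\<in>T. \<Sum>j\<in>{j\<in>T. j < k}. joint_miss N {j, k} A B) = real ?t * (real ?t - 1) / 2" .
  \<comment> \<open>Twice the right side; it is nonnegative since no integer lies strictly between 1
    and 2.\<close>
  have "0 \<le> (real t - 1) * (real t - 2)" for t
    by (cases "t = 1"; cases "t = 0") (auto intro!: mult_nonneg_nonneg)
  from this[of ?t] have nonneg: "0 \<le> 1 - real ?t + real ?t * (real ?t - 1) / 2"
    by (simp add: field_simps)
  show ?case
  proof (cases "\<forall>k<length A. covered A B k")
    case True
    then have "{k \<in> T. \<not> covered A B k} = {}" using 1 by auto
    then have "?t = 0" by (simp only: card.empty)
    then show ?thesis unfolding s p by simp
  next
    case False
    then have "cover_prob 0 A B = 0" by simp
    then show ?thesis unfolding s p using nonneg by (simp only:)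
  qed
next
  case (2 d A B)
  have len: "length (A @ [a]) = length (B @ [b])" for a b using 2 by simp
  have "N \<le> 2 * length (A @ [a])" "N \<le> length (A @ [a]) + d" for a using 2 by simp_all
  note IH = 2(1-4)[OF len 2(6) this]
  have s1: "(\<Sum>k\<in>T. miss_prob k A B) =
    ((\<Sum>k\<in>T. miss_prob k (A @ [False]) (B @ [False])) + (\<Sum>k\<in>T. miss_prob k (A @ [False]) (B @ [True]))
   + (\<Sum>k\<in>T. miss_prob k (A @ [True]) (B @ [False])) + (\<Sum>k\<in>T. miss_prob k (A @ [True]) (B @ [True]))) / 4"
    by (subst miss_prob_step) (simp add: sum.distrib flip: sum_divide_distrib)
  have jm: "joint_miss N {j, k} A B =
    (joint_miss N {j, k} (A @ [False]) (B @ [False]) + joint_miss N {j, k} (A @ [False]) (B @ [True])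
   + joint_miss N {j, k} (A @ [True]) (B @ [False]) + joint_miss N {j, k} (A @ [True]) (B @ [True])) / 4"
    if "k \<in> T" "j \<in> {j \<in> T. j < k}" for j k
    using that 2 by (intro joint_miss_step) auto
  have "(\<Sum>k\<in>T. \<Sum>j\<in>{j\<in>T. j < k}. joint_miss N {j, k} A B) =
    (\<Sum>k\<in>T. \<Sum>j\<in>{j\<in>T. j < k}.
    (joint_miss N {j, k} (A @ [False]) (B @ [False]) + joint_miss N {j, k} (A @ [False]) (B @ [True])
   + joint_miss N {j, k} (A @ [True]) (B @ [False]) + joint_miss N {j, k} (A @ [True]) (B @ [True])) / 4)"
    by (intro sum.cong refl jm)
  also have "\<dots> = ((\<Sum>k\<in>T. \<Sum>j\<in>{j\<in>T. j < k}. joint_miss N {j, k} (A @ [False]) (B @ [False]))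
    + (\<Sum>k\<in>T. \<Sum>j\<in>{j\<in>T. j < k}. joint_miss N {j, k} (A @ [False]) (B @ [True]))
    + (\<Sum>k\<in>T. \<Sum>j\<in>{j\<in>T. j < k}. joint_miss N {j, k} (A @ [True]) (B @ [False]))
    + (\<Sum>k\<in>T. \<Sum>j\<in>{j\<in>T. j < k}. joint_miss N {j, k} (A @ [True]) (B @ [True]))) / 4"
    by (simp add: sum.distrib flip: sum_divide_distrib)
  finally show ?case using IH s1 by simp
qed

section \<open>Closed forms for single and joint misses\<close>

lemma sum_lessThan_add: "(\<Sum>k<m + n. f k) = (\<Sum>k<m. f k) + (\<Sum>k<n. f (m + k))"
  for f :: "nat \<Rightarrow> real"
  by (induction n) (simp_all add: add.assoc)

lemma prod_lessThan_add: "(\<Prod>k<m + n. f k) = (\<Prod>k<m. f k) * (\<Prod>k<n. f (m + k))"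
  for f :: "nat \<Rightarrow> real"
  by (induction n) (simp_all add: mult.assoc)

lemma prod_Un_disjoint3:
  assumes "finite X" "finite Y" "finite Z" "X \<inter> Y = {}" "X \<inter> Z = {}" "Y \<inter> Z = {}"
  shows "prod f (X \<union> Y \<union> Z) = prod f X * prod f Y * prod f Z"
  using assms by (simp add: prod.union_disjoint Int_Un_distrib2)

definition half_if2 :: "bool \<Rightarrow> bool \<Rightarrow> real" where
  "half_if2 a b = half_if a * half_if b"

lemma half_if_nonneg: "0 \<le> half_if b"
  by (simp add: half_if_def)

lemma half_if2_nonneg: "0 \<le> half_if2 a b"
  by (simp add: half_if2_def half_if_nonneg)

text \<open>The pairs with sum \<open>l + j\<close> fall into three ranges of \<open>i\<close>:
  revealed in \<open>A\<close> only, in both, in \<open>B\<close> only. The middle range yields the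
  indicator, the outer ones a factor 1/2 per revealed one.\<close>

lemma miss_prob_partial:
  assumes len: "length A = l" "length B = l" and "j < l"
  shows "miss_prob (l + j) A B
    = of_bool (\<not> covered A B (l + j)) * (\<Prod>i\<le>j. half_if2 (A ! i) (B ! i))"
proof -
  define k where "k = l + j"
  let ?f = "\<lambda>i. 1 - bitval A i * bitval B (k - i)"
  have "{..k} = ({..j} \<union> {j<..<l}) \<union> {l..k}" using \<open>j < l\<close> by (auto simp: k_def)
  then have "miss_prob k A B = prod ?f {..j} * prod ?f {j<..<l} * prod ?f {l..k}"
    unfolding miss_prob_def avoid_def using \<open>j < l\<close>
    by (simp only:) (rule prod_Un_disjoint3; force)
  moreover have "prod ?f {..j} = (\<Prod>i\<le>j. half_if (A ! i))"
    using len \<open>j < l\<close> by (intro prod.cong) (auto simp: bitval_def half_if_def k_def)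
  moreover have "prod ?f {l..k} = (\<Prod>i\<le>j. half_if (B ! i))"
    by (rule prod.reindex_bij_witness[of _ "\<lambda>i. k - i" "\<lambda>i. k - i"])
      (use len \<open>j < l\<close> in \<open>auto simp: bitval_def half_if_def k_def\<close>)
  moreover have "prod ?f {j<..<l} = (\<Prod>i\<in>{j<..<l}. 1 - of_bool (A ! i) * of_bool (B ! (k - i)))"
    using len \<open>j < l\<close> by (intro prod.cong) (auto simp: bitval_def k_def)
  moreover have "\<dots> = of_bool (\<forall>i\<in>{j<..<l}. \<not> (A ! i \<and> B ! (k - i)))"
    by (rule prod_zero_one) simp
  moreover have "(\<forall>i\<in>{j<..<l}. \<not> (A ! i \<and> B ! (k - i))) \<longleftrightarrow> \<not> covered A B k"
  proof -
    have "i \<le> k \<and> i < length A \<and> k - i < length B \<longleftrightarrow> i \<in> {j<..<l}" for i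
      using len \<open>j < l\<close> by (auto simp: k_def)
    then show ?thesis unfolding covered_def by blast
  qed
  ultimately show ?thesis by (simp add: k_def half_if2_def prod.distrib)
qed

text \<open>From \<open>2 * l\<close> on no pair is fully revealed. The middle \<open>Suc j\<close>
  pairs are wholly unrevealed and contribute \<open>3/4\<close> each.\<close>

lemma miss_prob_far:
  assumes len: "length A = l" "length B = l"
  shows "miss_prob (2 * l + j) A B = (\<Prod>i<l. half_if2 (A ! i) (B ! i)) * (3/4) ^ Suc j"
proof -
  define k where "k = 2 * l + j"
  let ?f = "\<lambda>i. 1 - bitval A i * bitval B (k - i)"
  have "{..k} = ({..<l} \<union> {l..<l + Suc j}) \<union> {l + Suc j..k}" by (auto simp: k_def)
  then have m: "miss_prob k A B = prod ?f {..<l} * prod ?f {l..<l + Suc j} * prod ?f {l + Suc j..k}"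
    unfolding miss_prob_def avoid_def
    by (simp only:) (rule prod_Un_disjoint3; force)
  have a: "prod ?f {..<l} = (\<Prod>i<l. half_if (A ! i))"
    using len by (intro prod.cong) (auto simp: bitval_def half_if_def k_def)
  have b: "prod ?f {l + Suc j..k} = (\<Prod>i<l. half_if (B ! i))"
    by (rule prod.reindex_bij_witness[of _ "\<lambda>i. k - i" "\<lambda>i. k - i"])
      (use len in \<open>auto simp: bitval_def half_if_def k_def\<close>)
  have "prod ?f {l..<l + Suc j} = (\<Prod>i\<in>{l..<l + Suc j}. 3/4)"
    using len by (intro prod.cong) (auto simp: bitval_def k_def)
  also have "\<dots> = (3/4) ^ Suc j" by (simp only: prod_constant card_atLeastLessThan add_diff_cancel_left')
  finally show ?thesis
    unfolding k_def[symmetric] m a b half_if2_def prod.distrib by (simp only: mult_ac)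
qed

lemma sum_three_quarters_le: "(\<Sum>j<d. (3/4 :: real) ^ Suc j) \<le> 3"
proof -
  have "(\<Sum>j<d. (3/4 :: real) ^ Suc j) = 3 - 3 * (3/4) ^ d"
    by (induction d) simp_all
  then show ?thesis by simp
qed

text \<open>Positions above \<open>l + p\<close> can be hit only through the larger number, which
  gives the first product; from \<open>l + p\<close> down both numbers can hit, hence the
  disjunctions with index shift \<open>Suc \<delta>\<close>.\<close>

lemma joint_miss_pair:
  assumes len: "length A = l" "length B = l" and "p + Suc \<delta> < l"
  shows "joint_miss (2 * l) {l + p, l + (p + Suc \<delta>)} A B =
    of_bool (\<not> covered A B (l + p) \<and> \<not> covered A B (l + (p + Suc \<delta>))) *
    ((\<Prod>i\<le>\<delta>. half_if2 (A ! i) (B ! i)) *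
     (\<Prod>i\<le>p. half_if2 (A ! i \<or> A ! (i + Suc \<delta>)) (B ! i \<or> B ! (i + Suc \<delta>))))"
proof -
  define q where "q = p + Suc \<delta>"
  define T where "T = {l + p, l + q}"
  define h where "h i = half_if2 (hit T A (l + q - i)) (hit T B (l + q - i))" for i
  have q: "q < l" "p < q" using assms by (simp_all add: q_def)
  have hit1: "hit T X (l + q - i) \<longleftrightarrow> X ! i" if "i \<le> \<delta>" "length X = l" for X i
    using that q unfolding hit_def T_def bit_at_def by (auto simp: q_def)
  have hit2: "hit T X (l + q - (Suc \<delta> + i)) \<longleftrightarrow> X ! i \<or> X ! (i + Suc \<delta>)"
    if "i \<le> p" "length X = l" for X i
  proof -
    have "l + q - (Suc \<delta> + i) = l + p - i" using that by (simp add: q_def)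
    moreover have "l + p - (l + p - i) = i" "l + q - (l + p - i) = i + Suc \<delta>"
      "l + p - i \<le> l + p" "l + p - i \<le> l + q"
      using that q by (simp_all add: q_def)
    moreover have "i < l" "i + Suc \<delta> < l" using that q by (simp_all add: q_def)
    ultimately show ?thesis using that(2) unfolding hit_def T_def bit_at_def by simp
  qed
  have "(\<Prod>x\<in>{length A..<2 * l}. half_if (hit T A x) * half_if (hit T B x))
      = (\<Prod>x\<in>{l..l + q}. half_if (hit T A x) * half_if (hit T B x))"
  proof (rule prod.mono_neutral_right)
    show "\<forall>x\<in>{length A..<2 * l} - {l..l + q}. half_if (hit T A x) * half_if (hit T B x) = 1"
      using q len by (auto simp: hit_def T_def)
  qed (use q len in auto)
  also have "\<dots> = (\<Prod>i<Suc \<delta> + Suc p. h i)"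
    by (rule prod.reindex_bij_witness[of _ "\<lambda>i. l + q - i" "\<lambda>x. l + q - x"])
      (auto simp: h_def half_if2_def q_def)
  also have "\<dots> = (\<Prod>i<Suc \<delta>. h i) * (\<Prod>i<Suc p. h (Suc \<delta> + i))"
    by (rule prod_lessThan_add)
  also have "(\<Prod>i<Suc \<delta>. h i) = (\<Prod>i\<le>\<delta>. half_if2 (A ! i) (B ! i))"
    unfolding lessThan_Suc_atMost using hit1 len by (intro prod.cong) (auto simp: h_def)
  also have "(\<Prod>i<Suc p. h (Suc \<delta> + i))
      = (\<Prod>i\<le>p. half_if2 (A ! i \<or> A ! (i + Suc \<delta>)) (B ! i \<or> B ! (i + Suc \<delta>)))"
    unfolding lessThan_Suc_atMost h_def using hit2 len by (intro prod.cong) auto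
  finally show ?thesis unfolding joint_miss_def T_def q_def by simp
qed

section \<open>Evaluation of the bounds\<close>

text \<open>All probabilities are multiplied by 4 ^ 10, so that for prefixes of length at most 10 every
  halving below is exact on numerals. The list S records which of the numbers from the prefix length l to
  2 * l - 1 are already covered. The sums are Horner schemes; \<open>shift_sum\<close> groups the pairs of missed
  numbers by their distance.\<close>

definition halve :: "bool \<Rightarrow> real \<Rightarrow> real" where
  "halve b x = half_if b * x"

definition unit_unless :: "bool \<Rightarrow> real" where
  "unit_unless c = (if c then 0 else 4 ^ 10)"

text \<open>The flag adds the tail of all numbers from \<open>2 * l\<close> on, whose series of
  ratio \<open>3/4\<close> sums to 3. It is set for the union bound only; the Bonferroni bound stops
  below \<open>2 * l\<close>.\<close>

fun single_sum :: "bool \<Rightarrow> bool list \<Rightarrow> bool list \<Rightarrow> bool list \<Rightarrow> real" where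
  "single_sum t (a # A) (b # B) (s # S) = halve a (halve b (unit_unless s + single_sum t A B S))"
| "single_sum t _ _ _ = (if t then 3 * 4 ^ 10 else 0)"

fun pair_sum :: "bool list \<Rightarrow> bool list \<Rightarrow> bool list \<Rightarrow> bool list \<Rightarrow> bool list \<Rightarrow> bool list \<Rightarrow> real" where
  "pair_sum (a # A) (b # B) (s # S) (a' # A') (b' # B') (s' # S') =
     halve (a \<or> a') (halve (b \<or> b') (unit_unless (s \<or> s') + pair_sum A B S A' B' S'))"
| "pair_sum _ _ _ _ _ _ = 0"

text \<open>In use the primed lists are a suffix of the unprimed ones. Each dropped entry leaves its
  factor for a position that only the larger number reaches.\<close>

fun shift_sum :: "bool list \<Rightarrow> bool list \<Rightarrow> bool list \<Rightarrow> bool list \<Rightarrow> bool list \<Rightarrow> bool list \<Rightarrow> real" where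
  "shift_sum A B S (a' # A') (b' # B') (s' # S') =
     halve a' (halve b' (pair_sum A B S A' B' S' + shift_sum A B S A' B' S'))"
| "shift_sum _ _ _ _ _ _ = 0"

lemma single_sum_eq:
  assumes "length A = length B" "length B = length S"
  shows "single_sum t A B S =
    (\<Sum>j<length A. unit_unless (S ! j) * (\<Prod>i\<le>j. half_if2 (A ! i) (B ! i)))
    + (if t then 3 * 4 ^ 10 else 0) * (\<Prod>i<length A. half_if2 (A ! i) (B ! i))"
  using assms
proof (induction A B S rule: list_induct3)
  case (Cons a A b B s S)
  then show ?case
    by (simp add: sum.lessThan_Suc_shift prod.lessThan_Suc_shift prod.atMost_Suc_shift
        halve_def half_if2_def sum_distrib_left algebra_simps
        del: power_numeral sum.lessThan_Suc prod.lessThan_Suc prod.atMost_Suc)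
qed simp

lemma pair_sum_eq:
  assumes "length A' = length B'" "length B' = length S'"
    "length A' \<le> length A" "length A = length B" "length B = length S"
  shows "pair_sum A B S A' B' S' =
    (\<Sum>p<length A'. unit_unless (S ! p \<or> S' ! p) *
       (\<Prod>i\<le>p. half_if2 (A ! i \<or> A' ! i) (B ! i \<or> B' ! i)))"
  using assms
proof (induction A' B' S' arbitrary: A B S rule: list_induct3)
  case Nil
  then show ?case by (cases A; cases B; cases S) auto
next
  case (Cons a' A' b' B' s' S')
  from Cons.prems obtain a A1 b B1 s S1 where "A = a # A1" "B = b # B1" "S = s # S1"
    by (cases A; cases B; cases S) auto
  with Cons show ?case
    by (simp add: sum.lessThan_Suc_shift prod.atMost_Suc_shift
        halve_def half_if2_def sum_distrib_left algebra_simps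
        del: power_numeral sum.lessThan_Suc prod.atMost_Suc)
qed

lemma shift_sum_eq:
  assumes "length A' = length B'" "length B' = length S'"
  shows "shift_sum A B S A' B' S' =
    (\<Sum>\<delta><length A'. (\<Prod>i\<le>\<delta>. half_if2 (A' ! i) (B' ! i)) *
       pair_sum A B S (drop (Suc \<delta>) A') (drop (Suc \<delta>) B') (drop (Suc \<delta>) S'))"
  using assms
proof (induction A' B' S' rule: list_induct3)
  case (Cons a' A' b' B' s' S')
  then show ?case
    by (simp add: sum.lessThan_Suc_shift prod.atMost_Suc_shift halve_def half_if2_def
      sum_distrib_left algebra_simps del: sum.lessThan_Suc prod.atMost_Suc)
qed simp

section \<open>Bounds for tracked prefixes and their extension\<close>

definition tracks :: "bool list \<Rightarrow> bool list \<Rightarrow> bool list \<Rightarrow> bool" where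
  "tracks A B S \<longleftrightarrow> length B = length A \<and> length S = length A \<and>
     (\<forall>k<length A. covered A B k) \<and> (\<forall>j<length A. S ! j = covered A B (length A + j))"

lemma miss_prob_tracks:
  assumes "tracks A B S" "j < length A"
  shows "4 ^ 10 * miss_prob (length A + j) A B = unit_unless (S ! j) * (\<Prod>i\<le>j. half_if2 (A ! i) (B ! i))"
  using assms by (subst miss_prob_partial) (auto simp: tracks_def unit_unless_def)

lemma joint_miss_tracks:
  assumes "tracks A B S" "length A = l" "p + Suc \<delta> < l"
  shows "4 ^ 10 * joint_miss (2 * l) {l + p, l + (p + Suc \<delta>)} A B =
    (\<Prod>i\<le>\<delta>. half_if2 (A ! i) (B ! i)) * (unit_unless (S ! p \<or> S ! (p + Suc \<delta>)) *
     (\<Prod>i\<le>p. half_if2 (A ! i \<or> A ! (i + Suc \<delta>)) (B ! i \<or> B ! (i + Suc \<delta>))))"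
proof -
  have "S ! p = covered A B (l + p)" "S ! (p + Suc \<delta>) = covered A B (l + (p + Suc \<delta>))" "length B = l"
    using assms unfolding tracks_def by (metis add_lessD1, metis, metis)
  then show ?thesis
    using assms by (subst joint_miss_pair) (simp_all add: unit_unless_def)
qed

lemma uncovered_prob_le:
  assumes "tracks A B S"
  shows "4 ^ 10 * (1 - cover_prob d A B) \<le> single_sum True A B S"
proof -
  define l where "l = length A"
  have len: "length A = l" "length B = l" "length S = l" using assms by (auto simp: tracks_def l_def)
  let ?P = "\<Prod>i<l. half_if2 (A ! i) (B ! i)"
  have "1 - cover_prob d A B \<le> (\<Sum>k<l + d. miss_prob k A B)"
    using cover_prob_ge_union_bound[of A B d] len by simp
  \<comment> \<open>The range is lengthened so that it splits at \<open>l\<close> and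
    \<open>2 * l\<close> even when \<open>d < l\<close>.\<close>
  also have "\<dots> \<le> (\<Sum>k<l + (l + d). miss_prob k A B)"
    by (intro sum_mono2) (auto intro: miss_prob_nonneg)
  also have "\<dots> = (\<Sum>k<l. miss_prob k A B) + ((\<Sum>j<l. miss_prob (l + j) A B)
      + (\<Sum>j<d. miss_prob (l + (l + j)) A B))"
    by (simp only: sum_lessThan_add)
  also have "(\<Sum>k<l. miss_prob k A B) = 0"
    using assms by (intro sum.neutral) (auto simp: miss_prob_decided tracks_def l_def)
  also have "(\<Sum>j<d. miss_prob (l + (l + j)) A B) = ?P * (\<Sum>j<d. (3/4) ^ Suc j)"
    using miss_prob_far[OF len(1,2)] by (simp add: sum_distrib_left mult_2 add.assoc del: power_Suc)
  also have "\<dots> \<le> ?P * 3"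
    by (intro mult_left_mono sum_three_quarters_le prod_nonneg half_if2_nonneg ballI)
  finally have "1 - cover_prob d A B \<le> (\<Sum>j<l. miss_prob (l + j) A B) + ?P * 3" by simp
  then have "4 ^ 10 * (1 - cover_prob d A B) \<le> 4 ^ 10 * ((\<Sum>j<l. miss_prob (l + j) A B) + ?P * 3)"
    by (intro mult_left_mono) auto
  also have "\<dots> = (\<Sum>j<l. 4 ^ 10 * miss_prob (l + j) A B) + 3 * 4 ^ 10 * ?P"
    by (simp add: distrib_left sum_distrib_left)
  also have "\<dots> = single_sum True A B S"
    using len miss_prob_tracks[OF assms] by (simp add: single_sum_eq)
  finally show ?thesis .
qed

lemma sum_ordered_pairs:
  "(\<Sum>k\<in>{l..<2 * l}. \<Sum>j\<in>{j\<in>{l..<2 * l}. j < k}. f j k :: real)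
    = (\<Sum>\<delta><l. \<Sum>p<l - Suc \<delta>. f (l + p) (l + (p + Suc \<delta>)))" for l :: nat
proof -
  have "(\<Sum>k\<in>{l..<2 * l}. \<Sum>j\<in>{j\<in>{l..<2 * l}. j < k}. f j k)
      = (\<Sum>(k, j)\<in>(SIGMA k:{l..<2 * l}. {j\<in>{l..<2 * l}. j < k}). f j k)"
    by (rule sum.Sigma) auto
  also have "\<dots> = (\<Sum>(\<delta>, p)\<in>(SIGMA \<delta>:{..<l}. {..<l - Suc \<delta>}). f (l + p) (l + (p + Suc \<delta>)))"
    by (rule sum.reindex_bij_witness[of _ "\<lambda>(\<delta>, p). (l + (p + Suc \<delta>), l + p)" "\<lambda>(k, j). (k - Suc j, j - l)"])
      (clarsimp, arith?)+
  also have "\<dots> = (\<Sum>\<delta><l. \<Sum>p<l - Suc \<delta>. f (l + p) (l + (p + Suc \<delta>)))"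
    by (rule sum.Sigma[symmetric]) auto
  finally show ?thesis .
qed

text \<open>Bonferroni is applied to the numbers from \<open>l\<close> to \<open>2 * l - 1\<close>;
  \<open>length A \<le> d\<close> makes them all decided after \<open>d\<close> steps.\<close>

lemma uncovered_prob_ge:
  assumes "tracks A B S" "length A \<le> d"
  shows "single_sum False A B S - shift_sum A B S A B S \<le> 4 ^ 10 * (1 - cover_prob d A B)"
proof -
  define l where "l = length A"
  have len: "length A = l" "length B = l" "length S = l" using assms by (auto simp: tracks_def l_def)
  let ?J = "\<lambda>j k. joint_miss (2 * l) {j, k} A B"
  have "cover_prob d A B \<le> 1 - (\<Sum>k\<in>{l..<2 * l}. miss_prob k A B)
      + (\<Sum>k\<in>{l..<2 * l}. \<Sum>j\<in>{j\<in>{l..<2 * l}. j < k}. ?J j k)"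
    using len assms(2) by (intro cover_prob_le_bonferroni) auto
  also have "(\<Sum>k\<in>{l..<2 * l}. miss_prob k A B) = (\<Sum>j<l. miss_prob (l + j) A B)"
    by (rule sum.reindex_bij_witness[of _ "\<lambda>j. l + j" "\<lambda>k. k - l"]) auto
  also note sum_ordered_pairs
  finally have "(\<Sum>j<l. miss_prob (l + j) A B)
      - (\<Sum>\<delta><l. \<Sum>p<l - Suc \<delta>. ?J (l + p) (l + (p + Suc \<delta>))) \<le> 1 - cover_prob d A B"
    by simp
  then have "4 ^ 10 * ((\<Sum>j<l. miss_prob (l + j) A B)
      - (\<Sum>\<delta><l. \<Sum>p<l - Suc \<delta>. ?J (l + p) (l + (p + Suc \<delta>)))) \<le> 4 ^ 10 * (1 - cover_prob d A B)"
    by (intro mult_left_mono) auto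
  moreover have "4 ^ 10 * (\<Sum>j<l. miss_prob (l + j) A B) = single_sum False A B S"
    unfolding sum_distrib_left using len miss_prob_tracks[OF assms(1)] by (simp add: single_sum_eq)
  moreover have "4 ^ 10 * (\<Sum>\<delta><l. \<Sum>p<l - Suc \<delta>. ?J (l + p) (l + (p + Suc \<delta>))) = shift_sum A B S A B S"
  proof -
    have "pair_sum A B S (drop (Suc \<delta>) A) (drop (Suc \<delta>) B) (drop (Suc \<delta>) S) =
        (\<Sum>p<l - Suc \<delta>. unit_unless (S ! p \<or> S ! (p + Suc \<delta>)) *
          (\<Prod>i\<le>p. half_if2 (A ! i \<or> A ! (i + Suc \<delta>)) (B ! i \<or> B ! (i + Suc \<delta>))))" for \<delta>
      using len by (subst pair_sum_eq) (auto intro!: sum.cong prod.cong arg_cong2[where f = "(*)"] simp: add.commute)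
    then show ?thesis
      unfolding sum_distrib_left using len joint_miss_tracks[OF assms(1) len(1)]
      by (simp add: shift_sum_eq sum_distrib_left)
  qed
  ultimately show ?thesis by (simp only: right_diff_distrib)
qed

text \<open>It is called on tails because the recorded window moves from
  \<open>l, ..., 2 * l - 1\<close> to \<open>l + 1, ..., 2 * l + 1\<close>. Of the last two numbers,
  \<open>2 * l\<close> needs both new bits and \<open>2 * l + 1\<close> is out of reach.\<close>

fun extend_covered :: "bool \<Rightarrow> bool \<Rightarrow> bool list \<Rightarrow> bool list \<Rightarrow> bool list \<Rightarrow> bool list" where
  "extend_covered a b (s # S) (x # A) (y # B) = (s \<or> (a \<and> y) \<or> (b \<and> x)) # extend_covered a b S A B"
| "extend_covered a b _ _ _ = [a \<and> b, False]"

lemma extend_covered_eq: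
  assumes "length S = length A" "length A = length B"
  shows "length (extend_covered a b S A B) = length A + 2"
    "j < length A \<Longrightarrow> extend_covered a b S A B ! j \<longleftrightarrow> S ! j \<or> (a \<and> B ! j) \<or> (b \<and> A ! j)"
    "extend_covered a b S A B ! length A \<longleftrightarrow> a \<and> b"
    "\<not> extend_covered a b S A B ! Suc (length A)"
  using assms
proof (induction S A B arbitrary: j rule: list_induct3)
  case (Cons s S x A y B)
  { case 2 then show ?case using Cons.IH(2) by (cases j) auto }
qed auto

text \<open>Since 0 lies in both sets, either new bit being one covers \<open>length A\<close>
  itself; otherwise an old representation is required.\<close>

lemma tracks_extend:
  assumes tr: "tracks A B S" and "A \<noteq> []" "hd A" "hd B" "a \<or> b \<or> hd S"
  shows "tracks (A @ [a]) (B @ [b]) (extend_covered a b (tl S) (tl A) (tl B))"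
proof -
  define l where "l = length A"
  define E where "E = extend_covered a b (tl S) (tl A) (tl B)"
  have len: "length A = l" "length B = l" "length S = l" "0 < l"
    using assms by (auto simp: tracks_def l_def)
  have "A \<noteq> []" "B \<noteq> []" "S \<noteq> []" using len by auto
  then have zero: "A ! 0" "B ! 0" "hd S = S ! 0" using assms(3,4) by (simp_all add: hd_conv_nth)
  have S: "S ! j \<longleftrightarrow> covered A B (l + j)" if "j < l" for j
    using tr that by (auto simp: tracks_def l_def)
  have tl: "length (tl S) = length (tl A)" "length (tl A) = length (tl B)" "length (tl A) = l - 1"
    using len by simp_all
  note E = extend_covered_eq[OF tl(1,2), where a = a and b = b, folded E_def]
  have cov: "covered (A @ [a]) (B @ [b]) k" if "k < Suc l" for k
  proof (cases "k < l")
    case True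
    then show ?thesis using tr len by (simp add: covered_snoc_less tracks_def)
  next
    case False
    then have "k = l" using that by simp
    then show ?thesis using assms(5) zero S[of 0] len
      by (auto simp: covered_snoc bit_at_def)
  qed
  have new: "E ! j \<longleftrightarrow> covered (A @ [a]) (B @ [b]) (Suc l + j)" if j: "j < Suc l" for j
  proof -
    consider "j < l - 1" | "j = l - 1" | "j = l"
      using j len(4) by linarith
    then show ?thesis
    proof cases
      case 1
      then have "E ! j \<longleftrightarrow> S ! Suc j \<or> (a \<and> B ! Suc j) \<or> (b \<and> A ! Suc j)"
        using E(2)[of j] tl len by (simp add: nth_tl)
      moreover have "Suc l + j < 2 * l" "Suc l + j - l = Suc j" "Suc j < l" using 1 by auto
      ultimately show ?thesis
        using S[of "Suc j"] len by (simp add: covered_snoc bit_at_def)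
    next
      case 2
      then have "E ! j \<longleftrightarrow> a \<and> b" using E(3) tl by simp
      moreover have iff: "i \<le> Suc l + j \<and> i < length (A @ [a]) \<and> Suc l + j - i < length (B @ [b]) \<longleftrightarrow> i = l" for i
        using 2 len by auto
      have "covered (A @ [a]) (B @ [b]) (Suc l + j) \<longleftrightarrow> (A @ [a]) ! l \<and> (B @ [b]) ! (Suc l + j - l)"
        unfolding covered_def using iff by metis
      moreover have "Suc l + j - l = l" using 2 len by simp
      ultimately show ?thesis using len by (simp add: nth_append)
    next
      case 3
      then have "\<not> E ! j" using E(4) tl len by simp
      moreover have "\<not> (i < Suc l \<and> Suc l + j - i < Suc l)" for i
        using 3 by auto
      ultimately show ?thesis unfolding covered_def using len by auto
    qed
  qed
  show ?thesis
    unfolding tracks_def E_def[symmetric] using len E(1) tl cov new by simp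
qed

text \<open>The flag e says that A = B. Only one of the two mirror images of a child with A \<noteq> B is
  explored, with doubled mass.\<close>

definition scale :: "nat \<Rightarrow> bool \<Rightarrow> real \<Rightarrow> real" where
  "scale d e x = 4 ^ d * (if e then x else 2 * x)"

text \<open>The pair is (upper, lower), clipped before scaling because the enclosed quantity is a
  probability times \<open>4 ^ 10\<close>.\<close>

definition leaf_bounds :: "nat \<Rightarrow> bool \<Rightarrow> real \<Rightarrow> real \<Rightarrow> real \<Rightarrow> real \<times> real" where
  "leaf_bounds d e g s p =
    (scale d e (if g \<le> 4 ^ 10 then g else 4 ^ 10), scale d e (if p \<le> s then s - p else 0))"

text \<open>In the second case \<open>length A\<close> is missed for good, so the uncovered
  probability is exactly 1 and both bounds agree.\<close>

definition child_bounds where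
  "child_bounds f d e A B S a b = (if a \<or> b \<or> hd S
     then f e (A @ [a]) (B @ [b]) (extend_covered a b (tl S) (tl A) (tl B))
     else (scale d e (4 ^ 10), scale d e (4 ^ 10)))"

fun add_bounds :: "real \<times> real \<Rightarrow> real \<times> real \<Rightarrow> real \<times> real" where
  "add_bounds (x, y) (x', y') = (x + x', y + y')"

text \<open>The threshold and the depth 9 used below are tuned so that the final enclosure just fits.\<close>

fun bounds :: "nat \<Rightarrow> bool \<Rightarrow> bool list \<Rightarrow> bool list \<Rightarrow> bool list \<Rightarrow> real \<times> real" where
  "bounds 0 e A B S = leaf_bounds 0 e (single_sum True A B S) (single_sum False A B S) (shift_sum A B S A B S)"
| "bounds (Suc d) e A B S =
    (if scale (Suc d) e (single_sum True A B S) < 2800000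
     then leaf_bounds (Suc d) e (single_sum True A B S) (single_sum False A B S) (shift_sum A B S A B S)
     else add_bounds (child_bounds (bounds d) d e A B S False False)
       (add_bounds (child_bounds (bounds d) d e A B S True True)
         (if e then child_bounds (bounds d) d False A B S True False
          else add_bounds (child_bounds (bounds d) d False A B S True False)
                          (child_bounds (bounds d) d False A B S False True))))"

definition in_bounds :: "real \<Rightarrow> real \<times> real \<Rightarrow> bool" where
  "in_bounds x I \<longleftrightarrow> x \<le> fst I \<and> snd I \<le> x"

lemma in_bounds_add: "in_bounds x I \<Longrightarrow> in_bounds y J \<Longrightarrow> in_bounds (x + y) (add_bounds I J)"
  by (cases I; cases J) (simp add: in_bounds_def)

lemma scale_mono: "x \<le> y \<Longrightarrow> scale d e x \<le> scale d e y"
  by (simp add: scale_def)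

lemma in_bounds_leaf:
  assumes "tracks A B S" "length A \<le> n"
  shows "in_bounds (scale d e (4 ^ 10 * (1 - cover_prob n A B)))
    (leaf_bounds d e (single_sum True A B S) (single_sum False A B S) (shift_sum A B S A B S))"
proof -
  have "4 ^ 10 * (1 - cover_prob n A B) \<le> 4 ^ 10" "0 \<le> 4 ^ 10 * (1 - cover_prob n A B)"
    using cover_prob_nonneg[of n A B] cover_prob_le_1[of n A B] by simp_all
  then show ?thesis
    unfolding in_bounds_def leaf_bounds_def fst_conv snd_conv
    using uncovered_prob_le[OF assms(1), of n] uncovered_prob_ge[OF assms]
    by (intro conjI scale_mono) (simp_all only: simp_thms split: if_split)
qed

text \<open>A step to a child lengthens the prefix by one and uses up one of the \<open>n\<close>
  remaining steps, hence \<open>2 * d\<close>: wherever the search stops, \<open>n\<close> is still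
  at least the prefix length, as \<open>in_bounds_leaf\<close> needs.\<close>

lemma in_bounds_bounds:
  assumes "tracks A B S" "A \<noteq> []" "hd A" "hd B" "e \<Longrightarrow> A = B" "length A + 2 * d \<le> n"
  shows "in_bounds (scale d e (4 ^ 10 * (1 - cover_prob n A B))) (bounds d e A B S)"
  using assms
proof (induction d arbitrary: e A B S n)
  case 0
  then show ?case using in_bounds_leaf[of A B S n] by simp
next
  case (Suc d)
  show ?case
  proof (cases "scale (Suc d) e (single_sum True A B S) < 2800000")
    case True
    then show ?thesis using in_bounds_leaf[of A B S n "Suc d" e] Suc.prems by simp
  next
    case False
    obtain n' where n: "n = Suc n'" "length A + 1 + 2 * d \<le> n'" using Suc.prems(6) by (cases n) auto
    have len: "length A = length B" using Suc.prems by (simp add: tracks_def)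
    then have "B \<noteq> []" using Suc.prems(2) by auto
    define x where "x a b = 4 ^ 10 * (1 - cover_prob n' (A @ [a]) (B @ [b]))" for a b
    have child: "in_bounds (scale d e' (x a b)) (child_bounds (bounds d) d e' A B S a b)"
      if "e' \<Longrightarrow> A = B \<and> a = b" for e' a b
    proof (cases "a \<or> b \<or> hd S")
      case True
      then have "in_bounds (scale d e' (x a b))
          (bounds d e' (A @ [a]) (B @ [b]) (extend_covered a b (tl S) (tl A) (tl B)))"
        unfolding x_def using Suc.prems n that len \<open>B \<noteq> []\<close>
        by (intro Suc.IH tracks_extend) auto
      with True show ?thesis by (simp only: child_bounds_def if_True)
    next
      case uncov: False
      have "S \<noteq> []" using Suc.prems(1,2) by (auto simp: tracks_def)
      then have "S ! 0 = covered A B (length A)" "hd S = S ! 0"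
        using Suc.prems(1,2) by (simp_all add: tracks_def hd_conv_nth)
      then have "\<not> covered (A @ [a]) (B @ [b]) (length A)"
        using uncov covered_snoc[OF len, of "length A" a b] Suc.prems(2) by auto
      then have "cover_prob n' (A @ [a]) (B @ [b]) = 0"
        using len by (intro cover_prob_eq_0) auto
      then show ?thesis
        using uncov by (simp add: child_bounds_def in_bounds_def x_def)
    qed
    have total: "4 ^ 10 * (1 - cover_prob n A B) = (x False False + x False True + x True False + x True True) / 4"
    proof -
      have "c * (1 - (y1 + y2 + y3 + y4) / 4) = (c * (1 - y1) + c * (1 - y2) + c * (1 - y3) + c * (1 - y4)) / 4"
        for c y1 y2 y3 y4 :: real by (simp add: field_simps)
      then show ?thesis unfolding n(1) cover_prob.simps x_def .
    qed
    show ?thesis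
    proof (cases e)
      case True
      then have "A = B" using Suc.prems by simp
      \<comment> \<open>The mixed children are mirror images, so one of them with doubled mass
        stands for both.\<close>
      then have "x False True = x True False"
        unfolding x_def by (simp add: cover_prob_commute[of "B @ [False]"])
      then have "scale (Suc d) e (4 ^ 10 * (1 - cover_prob n A B))
          = scale d e (x False False) + (scale d e (x True True) + scale d False (x True False))"
        unfolding total using True by (simp add: scale_def distrib_left)
      moreover have "in_bounds \<dots> (bounds (Suc d) e A B S)"
        unfolding bounds.simps if_not_P[OF False] if_P[OF True]
        by (intro in_bounds_add child) (simp_all add: \<open>A = B\<close>)
      ultimately show ?thesis by (simp only:)
    next
      case ne: False
      then have "scale (Suc d) e (4 ^ 10 * (1 - cover_prob n A B))
          = scale d e (x False False) + (scale d e (x True True) + (scale d False (x True False) + scale d False (x False True)))"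
        unfolding total by (simp add: scale_def distrib_left)
      moreover have "in_bounds \<dots> (bounds (Suc d) e A B S)"
        unfolding bounds.simps if_not_P[OF False] if_not_P[OF ne]
        by (intro in_bounds_add child) (simp_all add: ne)
      ultimately show ?thesis by (simp only:)
    qed
  qed
qed

text \<open>Halving deletes a trailing binary 0 of a numeral, so no fraction ever arises: at most 10
  positions with two halvings each act on multiples of \<open>4 ^ 10\<close>.\<close>

lemma halve_eval: "halve True (numeral (Num.Bit0 n)) = numeral n" "halve True 0 = 0" "halve False x = x"
proof -
  have "halve True (2 * y) = y" for y by (simp add: halve_def)
  then show "halve True (numeral (Num.Bit0 n)) = numeral n" unfolding numeral_Bit0_eq_double[of n] .
qed (simp_all add: halve_def)

lemma unit_unless_eval: "unit_unless True = 0" "unit_unless False = 1048576"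
  by (simp_all add: unit_unless_def)

lemma single_sum_eval:
  "single_sum t (a # A) (b # B) (s # S) = halve a (halve b (unit_unless s + single_sum t A B S))"
  "single_sum True [] [] [] = 3145728" "single_sum False [] [] [] = 0"
  by simp_all

lemma pair_sum_Nil: "pair_sum A B S [] [] [] = 0"
  by (cases A; cases B; cases S) auto

lemma shift_sum_eval:
  "shift_sum A B S (a' # A') (b' # B') (s' # S') =
     halve a' (halve b' (pair_sum A B S A' B' S' + shift_sum A B S A' B' S'))"
  "shift_sum A B S [] [] [] = 0"
  by simp_all

lemma extend_covered_eval:
  "extend_covered a b (s # S) (x # A) (y # B) = (s \<or> (a \<and> y) \<or> (b \<and> x)) # extend_covered a b S A B"
  "extend_covered a b [] [] [] = [a \<and> b, False]"
  by simp_all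

lemma scale_eval:
  "scale 0 True x = x" "scale 0 False (numeral n) = numeral (Num.Bit0 n)"
  "scale (Suc d) e (numeral n) = scale d e (numeral (Num.Bit0 (Num.Bit0 n)))" "scale d e 0 = 0"
proof -
  have "scale 0 False y = 2 * y" "scale (Suc d) e y = scale d e (2 * (2 * y))" for y
    by (simp_all add: scale_def)
  then show "scale 0 False (numeral n) = numeral (Num.Bit0 n)"
    "scale (Suc d) e (numeral n) = scale d e (numeral (Num.Bit0 (Num.Bit0 n)))"
    unfolding numeral_Bit0_eq_double[of n] numeral_Bit0_eq_double[of "Num.Bit0 n"] by blast+
qed (simp_all add: scale_def)

lemma leaf_bounds_eval:
  "leaf_bounds d e g s p =
    (scale d e (if g \<le> 1048576 then g else 1048576), scale d e (if p \<le> s then s - p else 0))"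
  by (simp add: leaf_bounds_def)

lemma child_bounds_eval:
  "child_bounds f d e A B S a b = (if a \<or> b \<or> hd S
     then f e (A @ [a]) (B @ [b]) (extend_covered a b (tl S) (tl A) (tl B))
     else (scale d e 1048576, scale d e 1048576))"
  by (simp add: child_bounds_def)

lemmas bounds_eval = halve_eval unit_unless_eval single_sum_eval pair_sum.simps(1) pair_sum_Nil shift_sum_eval
  extend_covered_eval scale_eval leaf_bounds_eval child_bounds_eval add_bounds.simps bounds.simps
  append.simps list.sel simp_thms if_True if_False arith_simps rel_simps add_0_left add_0_right

lemma bounds_value:
  "bounds 9 True [True] [True] [False] = (141089615872, 140141905344)"
proof -
  \<comment> \<open>The depth is spelled out with \<open>Suc\<close> so that the recursion equations
    match. Both entries carry the factor \<open>4 ^ 9 * 4 ^ 10\<close>.\<close>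
  have "bounds (Suc (Suc (Suc (Suc (Suc (Suc (Suc (Suc (Suc 0))))))))) True [True] [True] [False]
      = (141089615872, 140141905344)"
    \<comment> \<open>The weak congruence leaves branches untouched until the condition is decided,
      so pruned subtrees are never expanded.\<close>
    by (simp only: bounds_eval cong: if_weak_cong)
  then show ?thesis by (simp only: numeral_nat)
qed

lemma cover_prob_bounds:
  assumes "20 \<le> d"
  shows "0.48666 \<le> 4 * cover_prob d [] []" "4 * cover_prob d [] [] \<le> 0.49017"
proof -
  \<comment> \<open>\<open>19 = 1 + 2 * 9\<close>: the root prefix has one bit and the search has
    depth 9.\<close>
  obtain n where n: "d = Suc n" "19 \<le> n" using assms by (cases d) auto
  have "cover_prob n [a] [b] = 0" if "\<not> (a \<and> b)" for a b
    using that by (intro cover_prob_eq_0[of _ _ 0]) (auto simp: covered_def)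
  \<comment> \<open>Unless both sets contain 0, the number 0 is missed; one of the four choices of
    first bits survives, which explains the factor 4.\<close>
  then have d: "4 * cover_prob d [] [] = cover_prob n [True] [True]"
    by (simp add: n)
  have "covered [True] [True] 0" "\<not> covered [True] [True] 1"
    by (auto simp: covered_def)
  then have "tracks [True] [True] [False]" by (simp add: tracks_def)
  then have "in_bounds (scale 9 True (4 ^ 10 * (1 - cover_prob n [True] [True])))
      (141089615872, 140141905344)"
    using in_bounds_bounds[of "[True]" "[True]" "[False]" True 9 n] n(2)
    by (simp add: bounds_value)
  then show "0.48666 \<le> 4 * cover_prob d [] []" "4 * cover_prob d [] [] \<le> 0.49017"
    unfolding d in_bounds_def scale_def by simp_all
qed

theorem theorem1p4:
  shows "\<exists>c::real. 0.2433 < c \<and> c < 0.2451 \<and>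
           (\<lambda>n. real (num_complete_rulers n) / 2 ^ n) \<longlonglongrightarrow> c"
proof -
  obtain p where p: "(\<lambda>d. cover_prob d [] []) \<longlonglongrightarrow> p"
    and lim: "(\<lambda>n. real (num_complete_rulers n) / 2 ^ n) \<longlonglongrightarrow> 2 * p"
    by (rule num_complete_rulers_tendsto)
  from p have p4: "(\<lambda>d. 4 * cover_prob d [] []) \<longlonglongrightarrow> 4 * p" by (intro tendsto_intros)
  \<comment> \<open>The enclosure holds for all \<open>d \<ge> 20\<close> and passes to the limit;
    halving it encloses \<open>2 * p\<close>.\<close>
  have "0.48666 \<le> 4 * p"
    by (rule LIMSEQ_le_const[OF p4]) (use cover_prob_bounds(1) in blast)
  moreover have "4 * p \<le> 0.49017"
    by (rule LIMSEQ_le_const2[OF p4]) (use cover_prob_bounds(2) in blast)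
  ultimately have "0.2433 < 2 * p \<and> 2 * p < 0.2451" by simp
  with lim show ?thesis by blast
qed

end
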